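(* Let $n\ge 1$ be an integer, let $Y$ be a topological space with at least $n$ points, and let $X=C^n(Y\times I)$. Suppose $Y$ admits $n-1$ fixed-point-free continuous maps $f_i\colon Y\to Y$ ($i=1,2,\dots,n-1$) satisfying $f_i(y)\neq f_j(y)$ for all $y\in Y$ and all $i\neq j$. Then $$\mathrm{TC}_X(C^n(Y)\times C^n(Y))\ge \mathrm{TC}(Y).$$
   Context: $I=[0,1]$. For a space $X$, $P(X)$ is the space of all continuous maps $\sigma\colon I\to X$ with the compact-open topology. $\mathrm{TC}(X)$ is the smallest integer $k$ such that $X\times X$ has an open cover $U_1,\dots,U_k$ for which there are continuous maps $s_i\colon U_i\to P(X)$ with $s_i(x,y)(0)=x$ and $s_i(x,y)(1)=y$ for all $(x,y)\in U_i$; if no such $k$ exists, $\mathrm{TC}(X)=\infty$. For $A\subseteq X\times X$, $P_X(A)\subseteq P(X)$ is the subspace of paths $\sigma$ with $(\sigma(0),\sigma(1))\in A$, and $\mathrm{TC}_X(A)$ is the smallest integer $k$ such that $A$ has a cover by sets $U_1,\dots,U_k$ open in $A$ for which there are continuous maps $s_i\colon U_i\to P_X(A)$ with $s_i(x,y)(0)=x$ and $s_i(x,y)(1)=y$ for all $(x,y)\in U_i$; if no such $k$ exists, $\mathrm{TC}_X(A)=\infty$. (Paths may leave the subspaces in which their endpoints lie.) For any space $Z$, $C^n(Z)=\{(z_1,\dots,z_n)\in Z^n : z_i\neq z_j\text{ for }i\ne j\}$ with the subspace topology from $Z^n$. $Y$ is identified with the subspace $Y\times\{0\}$ of $Y\times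 I$, and correspondingly $C^n(Y)$ is viewed as a subspace of $C^n(Y\times I)$ via $(y_1,\dots,y_n)\mapsto((y_1,0),\dots,(y_n,0))$. A map $f\colon Y\to Y$ is fixed-point-free if $f(y)\ne y$ for all $y\in Y$. *)

theory Defs
  imports "HOL-Analysis.Analysis" "HOL-Library.Extended_Nat"
begin

abbreviation unit_interval :: "real topology" where
  "unit_interval \<equiv> top_of_set {0..1}"

text \<open>Spaces are values of type \<open>'a topology\<close>. A continuous map out of \<open>X\<close> is represented by the
  unique function of the type that is \<open>undefined\<close> off \<open>topspace X\<close>, so that distinct points of the
  function space are distinct maps.\<close>

definition continuous_maps :: "'a topology \<Rightarrow> 'b topology \<Rightarrow> ('a \<Rightarrow> 'b) set" where
  "continuous_maps X Y = {f \<in> extensional (topspace X). continuous_map X Y f}"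

definition compact_open_topology :: "'a topology \<Rightarrow> 'b topology \<Rightarrow> ('a \<Rightarrow> 'b) topology" where
  "compact_open_topology X Y =
     topology_generated_by
       {{f \<in> continuous_maps X Y. f ` K \<subseteq> U} | K U. compactin X K \<and> openin Y U}"

lemma topspace_compact_open_topology:
  "topspace (compact_open_topology X Y) = continuous_maps X Y"
proof -
  have "continuous_maps X Y \<subseteq> \<Union> {{f \<in> continuous_maps X Y. f ` K \<subseteq> U} | K U. compactin X K \<and> openin Y U}"
  proof
    fix f assume "f \<in> continuous_maps X Y"
    then have "f \<in> {f \<in> continuous_maps X Y. f ` {} \<subseteq> {}}" by simp
    moreover have "compactin X {}" "openin Y {}" by auto
    ultimately show "f \<in> \<Union> {{f \<in> continuous_maps X Y. f ` K \<subseteq> U} | K U. compactin X K \<and> openin Y U}"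
      by blast
  qed
  then show ?thesis
    unfolding compact_open_topology_def topology_generated_by_topspace by blast
qed

definition path_space :: "'a topology \<Rightarrow> (real \<Rightarrow> 'a) topology" where
  "path_space X = compact_open_topology unit_interval X"

definition rel_path_space :: "'a topology \<Rightarrow> ('a \<times> 'a) set \<Rightarrow> (real \<Rightarrow> 'a) topology" where
  "rel_path_space X A = subtopology (path_space X) {\<sigma>. (\<sigma> 0, \<sigma> 1) \<in> A}"

definition has_motion_planners :: "'a topology \<Rightarrow> nat \<Rightarrow> bool" where
  "has_motion_planners X k \<longleftrightarrow>
     (\<exists>U s. (\<Union>i\<in>{1..k}. U i) = topspace X \<times> topspace X \<and>
        (\<forall>i\<in>{1..k}. openin (prod_topology X X) (U i) \<and>
           continuous_map (subtopology (prod_topology X X) (U i)) (path_space X) (s i) \<and>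
           (\<forall>(x, y)\<in>U i. s i (x, y) 0 = x \<and> s i (x, y) 1 = y)))"

definition TC :: "'a topology \<Rightarrow> enat" where
  "TC X = (if \<exists>k. has_motion_planners X k
           then enat (LEAST k. has_motion_planners X k) else \<infinity>)"

definition has_rel_motion_planners :: "'a topology \<Rightarrow> ('a \<times> 'a) set \<Rightarrow> nat \<Rightarrow> bool" where
  "has_rel_motion_planners X A k \<longleftrightarrow>
     (\<exists>U s. (\<Union>i\<in>{1..k}. U i) = A \<and>
        (\<forall>i\<in>{1..k}. openin (subtopology (prod_topology X X) A) (U i) \<and>
           continuous_map (subtopology (prod_topology X X) (U i)) (rel_path_space X A) (s i) \<and>
           (\<forall>(x, y)\<in>U i. s i (x, y) 0 = x \<and> s i (x, y) 1 = y)))"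

text \<open>Only meaningful for \<open>A \<subseteq> topspace X \<times> topspace X\<close>.\<close>

definition TC_rel :: "'a topology \<Rightarrow> ('a \<times> 'a) set \<Rightarrow> enat" where
  "TC_rel X A = (if \<exists>k. has_rel_motion_planners X A k
                 then enat (LEAST k. has_rel_motion_planners X A k) else \<infinity>)"

text \<open>A point of \<open>Z\<^sup>n\<close> is an extensional function on \<open>{1..n}\<close>.\<close>

definition configuration_space :: "nat \<Rightarrow> 'a topology \<Rightarrow> (nat \<Rightarrow> 'a) topology" where
  "configuration_space n Z =
     subtopology (product_topology (\<lambda>_. Z) {1..n})
       {z. \<forall>i\<in>{1..n}. \<forall>j\<in>{1..n}. i \<noteq> j \<longrightarrow> z i \<noteq> z j}"

text \<open>The points of the configuration space of \<open>Y\<close>, placed in that of \<open>Y \<times> [0,1]\<close> at height 0.\<close>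

definition base_configurations :: "nat \<Rightarrow> 'a topology \<Rightarrow> (nat \<Rightarrow> 'a \<times> real) set" where
  "base_configurations n Y =
     (\<lambda>y. \<lambda>i\<in>{1..n}. (y i, 0)) ` topspace (configuration_space n Y)"

lemma base_configurations_subset:
  "base_configurations n Y
     \<subseteq> topspace (configuration_space n (prod_topology Y unit_interval))"
  by (auto simp: base_configurations_def configuration_space_def PiE_iff)

end

theory Submission
  imports Defs
begin

text \<open>The map \<open>y \<mapsto> (y, f\<^sub>1 y, \<dots>, f\<^bsub>n-1\<^esub> y)\<close> followed by the projection to the first point of a
  configuration and then to \<open>Y\<close> exhibits \<open>Y\<close> as a retract of \<open>C\<^sup>n(Y \<times> I)\<close>, with image in
  \<open>C\<^sup>n(Y)\<close>. Motion planners on \<open>C\<^sup>n(Y) \<times> C\<^sup>n(Y)\<close> therefore pull back to \<open>Y \<times> Y\<close>, and their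
  paths push forward to \<open>Y\<close>.\<close>

text \<open>The preimage of the subbasic set given by \<open>K\<close> and \<open>U\<close> is again
  subbasic, given by \<open>K\<close> and the preimage of \<open>U\<close> under \<open>g\<close>.
  The restriction returns the composite to its extensional representative.\<close>

lemma continuous_map_compact_open_topology_compose:
  assumes "continuous_map Y Z g"
  shows "continuous_map (compact_open_topology X Y) (compact_open_topology X Z)
           (\<lambda>\<sigma>. restrict (g \<circ> \<sigma>) (topspace X))"
proof -
  let ?c = "\<lambda>\<sigma>. restrict (g \<circ> \<sigma>) (topspace X)"
  have maps: "?c \<sigma> \<in> continuous_maps X Z" if "\<sigma> \<in> continuous_maps X Y" for \<sigma>
    using that continuous_map_compose[OF _ assms, of X \<sigma>]
    by (auto simp: continuous_maps_def intro: continuous_map_eq)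
  have "continuous_map (compact_open_topology X Y)
          (topology_generated_by
            {{f \<in> continuous_maps X Z. f ` K \<subseteq> U} | K U. compactin X K \<and> openin Z U}) ?c"
  proof (rule continuous_on_generated_topo)
    fix W assume "W \<in> {{f \<in> continuous_maps X Z. f ` K \<subseteq> U} | K U. compactin X K \<and> openin Z U}"
    then obtain K U where W: "W = {f \<in> continuous_maps X Z. f ` K \<subseteq> U}"
      and K: "compactin X K" and U: "openin Z U"
      by blast
    \<comment> \<open>Hence on \<open>K\<close> the restricted composite agrees with
      \<open>g \<circ> \<sigma>\<close>.\<close>
    have KX: "K \<subseteq> topspace X"
      using K by (rule compactin_subset_topspace)
    let ?V = "{y \<in> topspace Y. g y \<in> U}"
    have "?c -` W \<inter> topspace (compact_open_topology X Y) = {f \<in> continuous_maps X Y. f ` K \<subseteq> ?V}"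
    proof (intro set_eqI iffI)
      fix \<sigma> assume "\<sigma> \<in> ?c -` W \<inter> topspace (compact_open_topology X Y)"
      then have \<sigma>: "\<sigma> \<in> continuous_maps X Y" and "?c \<sigma> ` K \<subseteq> U"
        by (auto simp: W topspace_compact_open_topology)
      then show "\<sigma> \<in> {f \<in> continuous_maps X Y. f ` K \<subseteq> ?V}"
        using KX by (fastforce simp: continuous_maps_def continuous_map_def image_subset_iff)
    next
      fix \<sigma> assume "\<sigma> \<in> {f \<in> continuous_maps X Y. f ` K \<subseteq> ?V}"
      then show "\<sigma> \<in> ?c -` W \<inter> topspace (compact_open_topology X Y)"
        using maps KX by (auto simp: W topspace_compact_open_topology)
    qed
    moreover have "openin Y ?V"
      using openin_continuous_map_preimage[OF assms U] .
    ultimately show "openin (compact_open_topology X Y)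
                       (?c -` W \<inter> topspace (compact_open_topology X Y))"
      using K unfolding compact_open_topology_def[of X Y]
      by (auto intro!: topology_generated_by_Basis)
  next
    \<comment> \<open>The union of the generators is the whole of
      \<open>continuous_maps X Z\<close>, so \<open>maps\<close> suffices.\<close>
    show "?c ` topspace (compact_open_topology X Y)
            \<subseteq> \<Union> {{f \<in> continuous_maps X Z. f ` K \<subseteq> U} | K U. compactin X K \<and> openin Z U}"
      using maps topspace_compact_open_topology[of X Z]
      unfolding topspace_compact_open_topology
      by (auto simp: compact_open_topology_def topology_generated_by_topspace)
  qed
  then show ?thesis
    by (simp add: compact_open_topology_def)
qed

text \<open>A path in \<open>X\<close> from \<open>F x\<close> to \<open>F y\<close> is sent by
  \<open>P\<close> to a path in \<open>Y\<close> from \<open>x\<close> to \<open>y\<close>, even if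
  it leaves the image of \<open>F\<close> in between. One planner on \<open>Y\<close> arises from
  each planner on \<open>A\<close>, so \<open>k\<close> is preserved.\<close>

lemma has_motion_planners_retract:
  assumes F: "continuous_map Y X F" and P: "continuous_map X Y P"
    and PF: "\<And>y. y \<in> topspace Y \<Longrightarrow> P (F y) = y"
    and FA: "\<And>x y. x \<in> topspace Y \<Longrightarrow> y \<in> topspace Y \<Longrightarrow> (F x, F y) \<in> A"
    and planners: "has_rel_motion_planners X A k"
  shows "has_motion_planners Y k"
proof -
  from planners obtain U s where cover: "(\<Union>i\<in>{1..k}. U i) = A"
    and U: "\<And>i. i \<in> {1..k} \<Longrightarrow> openin (subtopology (prod_topology X X) A) (U i)"
    and s: "\<And>i. i \<in> {1..k} \<Longrightarrow>
              continuous_map (subtopology (prod_topology X X) (U i)) (rel_path_space X A) (s i)"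
    and ends: "\<And>i x y. i \<in> {1..k} \<Longrightarrow> (x, y) \<in> U i \<Longrightarrow> s i (x, y) 0 = x \<and> s i (x, y) 1 = y"
    unfolding has_rel_motion_planners_def by blast
  define FF where "FF = (\<lambda>(x, y). (F x, F y))"
  define V where "V i = {p \<in> topspace (prod_topology Y Y). FF p \<in> U i}" for i
  define t where "t i = (\<lambda>\<sigma>. restrict (P \<circ> \<sigma>) {0..1}) \<circ> (s i \<circ> FF)" for i
  have "continuous_map (prod_topology Y Y) (prod_topology X X) FF"
    using continuous_map_compose[OF continuous_map_fst[of Y Y] F]
      continuous_map_compose[OF continuous_map_snd[of Y Y] F]
    unfolding FF_def by (simp add: case_prod_unfold continuous_map_pairwise o_def)
  then have FF: "continuous_map (prod_topology Y Y) (subtopology (prod_topology X X) A) FF"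
    using FA by (auto simp: continuous_map_in_subtopology FF_def)
  have "(\<Union>i\<in>{1..k}. V i) = topspace Y \<times> topspace Y"
    using cover FA by (auto simp: V_def FF_def)
  moreover have "openin (prod_topology Y Y) (V i)" if "i \<in> {1..k}" for i
    unfolding V_def using openin_continuous_map_preimage[OF FF U[OF that]] .
  moreover have "continuous_map (subtopology (prod_topology Y Y) (V i)) (path_space Y) (t i)"
    if i: "i \<in> {1..k}" for i
  proof -
    have "continuous_map (subtopology (prod_topology Y Y) (V i))
            (subtopology (prod_topology X X) (U i)) FF"
      using FF by (auto simp: continuous_map_in_subtopology V_def
          intro: continuous_map_from_subtopology)
    \<comment> \<open>The endpoint constraint of the relative path space is forgotten here, so that
      composition with \<open>P\<close> applies to all paths in \<open>X\<close>.\<close>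
    moreover have "continuous_map (subtopology (prod_topology X X) (U i)) (path_space X) (s i)"
      using s[OF i] by (simp add: rel_path_space_def continuous_map_in_subtopology)
    moreover have "continuous_map (path_space X) (path_space Y) (\<lambda>\<sigma>. restrict (P \<circ> \<sigma>) {0..1})"
      using continuous_map_compact_open_topology_compose[OF P, of unit_interval]
      by (simp add: path_space_def)
    ultimately show ?thesis
      unfolding t_def by (blast intro: continuous_map_compose)
  qed
  moreover have "\<forall>(x, y)\<in>V i. t i (x, y) 0 = x \<and> t i (x, y) 1 = y" if "i \<in> {1..k}" for i
    using ends[OF that] PF by (auto simp: V_def t_def FF_def)
  ultimately show ?thesis
    unfolding has_motion_planners_def by (intro exI[of _ V] exI[of _ t]) simp
qed

text \<open>The least relative \<open>k\<close> is a candidate in the minimum defining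
  \<open>TC Y\<close>; if there is none, the right-hand side is \<infinity>.\<close>

lemma TC_le_TC_rel:
  assumes "\<And>k. has_rel_motion_planners X A k \<Longrightarrow> has_motion_planners Y k"
  shows "TC Y \<le> TC_rel X A"
proof (cases "\<exists>k. has_rel_motion_planners X A k")
  case True
  then have "has_rel_motion_planners X A (LEAST k. has_rel_motion_planners X A k)"
    by (rule LeastI_ex)
  then have "has_motion_planners Y (LEAST k. has_rel_motion_planners X A k)"
    by (rule assms)
  then show ?thesis
    using True by (auto simp: TC_def TC_rel_def intro: Least_le)
qed (simp add: TC_rel_def)

theorem theorem3p6:
  fixes n :: nat and Y :: "'a topology" and f :: "nat \<Rightarrow> 'a \<Rightarrow> 'a"
    and X :: "(nat \<Rightarrow> 'a \<times> real) topology"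
  assumes "n \<ge> 1"
    and "\<exists>S \<subseteq> topspace Y. finite S \<and> card S = n"
    and "X = configuration_space n (prod_topology Y unit_interval)"
    and "\<And>i. i \<in> {1..n-1} \<Longrightarrow> continuous_map Y Y (f i)"
    and "\<And>i y. i \<in> {1..n-1} \<Longrightarrow> y \<in> topspace Y \<Longrightarrow> f i y \<noteq> y"
    and "\<And>i j y. i \<in> {1..n-1} \<Longrightarrow> j \<in> {1..n-1} \<Longrightarrow> i \<noteq> j \<Longrightarrow> y \<in> topspace Y \<Longrightarrow> f i y \<noteq> f j y"
  shows "TC_rel X (base_configurations n Y \<times> base_configurations n Y) \<ge> TC Y"
proof -
  \<comment> \<open>The identity takes slot 1 and the given maps are shifted by one, making
    \<open>n\<close> maps in all. Being fixed-point-free then means differing everywhere from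
    \<open>g 1\<close>.\<close>
  define g where "g i = (if i = 1 then id else f (i - 1))" for i
  have g: "continuous_map Y Y (g i)" if "i \<in> {1..n}" for i
  proof (cases "i = 1")
    case False
    then have "i - 1 \<in> {1..n-1}"
      using that by auto
    then show ?thesis
      using assms(4) False by (simp add: g_def)
  qed (simp add: g_def)
  have g_neq: "g i y \<noteq> g j y" if "i \<in> {1..n}" "j \<in> {1..n}" "i \<noteq> j" "y \<in> topspace Y" for i j y
  proof (cases "i = 1 \<or> j = 1")
    case True
    then show ?thesis
      using that assms(5)[of "i - 1" y] assms(5)[of "j - 1" y]
      by (fastforce simp: g_def)
  next
    case False
    then have "i - 1 \<in> {1..n-1}" "j - 1 \<in> {1..n-1}" "i - 1 \<noteq> j - 1"
      using that by auto
    then show ?thesis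
      using assms(6) that False by (simp add: g_def)
  qed
  have g_in: "g i y \<in> topspace Y" if "i \<in> {1..n}" "y \<in> topspace Y" for i y
    using continuous_map_funspace[OF g[OF that(1)]] that(2) by (rule funcset_mem)
  define F where "F y = (\<lambda>i\<in>{1..n}. (g i y, 0 :: real))" for y
  have F_base: "F y \<in> base_configurations n Y" if y: "y \<in> topspace Y" for y
  proof -
    have "(\<lambda>i\<in>{1..n}. g i y) \<in> topspace (configuration_space n Y)"
      using g_in[OF _ y] g_neq[OF _ _ _ y] by (simp add: configuration_space_def)
    \<comment> \<open>This exhibits \<open>F y\<close> as the height-0 copy of a configuration in
      \<open>Y\<close>.\<close>
    moreover have "F y = (\<lambda>i\<in>{1..n}. ((\<lambda>i\<in>{1..n}. g i y) i, 0))"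
      by (auto simp: F_def)
    ultimately show ?thesis
      unfolding base_configurations_def by blast
  qed
  have "continuous_map Y (product_topology (\<lambda>_. prod_topology Y unit_interval) {1..n}) F"
    using g by (auto simp: continuous_map_componentwise F_def continuous_map_pairwise o_def)
  then have F: "continuous_map Y X F"
    using g_neq by (auto simp: assms(3) configuration_space_def continuous_map_in_subtopology F_def)
  \<comment> \<open>Since \<open>n \<ge> 1\<close>, index 1 is a genuine coordinate, and there
    \<open>F y\<close> has the entry \<open>(y, 0)\<close>. Dropping the height recovers
    \<open>y\<close>.\<close>
  have proj: "continuous_map X (prod_topology Y unit_interval) (\<lambda>z. z 1)"
    using assms(1) unfolding assms(3) configuration_space_def
    by (intro continuous_map_from_subtopology continuous_map_product_projection) auto
  have P: "continuous_map X Y (\<lambda>z. fst (z 1))"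
    using continuous_map_compose[OF proj continuous_map_fst] by (simp add: o_def)
  have PF: "fst (F y 1) = y" for y
    using assms(1) by (simp add: F_def g_def)
  show ?thesis
  proof (rule TC_le_TC_rel)
    fix k
    assume "has_rel_motion_planners X (base_configurations n Y \<times> base_configurations n Y) k"
    then show "has_motion_planners Y k"
      by (rule has_motion_planners_retract[OF F P, rotated 2]) (simp_all add: PF[simplified] F_base)
  qed
qed

end
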